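(* Let $X$ be a Banach space with $\dim X\ge 2$, let $\Omega\subsetneq X$ be a domain, and let $x_0\in\Omega$ be such that $\Omega$ is starlike with respect to $x_0$. Then for every $r>0$ the balls $\mathbf{B}_j(x_0,r)$ and $\mathbf{B}_k(x_0,r)$ of $\Omega$ are starlike with respect to $x_0$.
   Context: A domain is a nonempty open connected set. A set $A\subset X$ is starlike with respect to $x_0\in A$ if $\{tx_0+(1-t)y:t\in[0,1]\}\subset A$ for all $y\in A$. For $x\in\Omega$ write $d(x)=d(x,\partial\Omega)$ for the norm distance to the boundary. Quasihyperbolic metric: for a rectifiable path $\gamma:[0,1]\to\Omega$, its quasihyperbolic length is $\ell_k(\gamma)=\int_{[0,1]}\frac{\|d\gamma\|}{d(\gamma(t))}$, where $\|d\gamma\|$ denotes integration with respect to the norm arc length of $\gamma$; the quasihyperbolic distance is $k(x,y)=\inf_\gamma\ell_k(\gamma)$ over all rectifiable paths $\gamma$ joining $x$ and $y$ in $\Omega$. The closed quasihyperbolic ball is $\mathbf{B}_k(x,r)=\{y\in\Omega:k(x,y)\le r\}$. Distance-ratio metric: $j(x,y)=\log\left(1+\frac{\|x-y\|}{\min\{d(x),d(y)\}}\right)$ for $x,y\in\Omega$, with closed balls $\mathbf{B}_j(x,r)=\{y\in\Omega:j(x,y)\le r\}$. *)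

theory Defs
  imports "HOL-Analysis.Analysis"
begin

text \<open>The library's \<open>starlike\<close> existentially quantifies the centre; here it is a parameter.\<close>

definition starlike_wrt :: "'a::real_vector \<Rightarrow> 'a set \<Rightarrow> bool" where
  "starlike_wrt x0 A \<longleftrightarrow> x0 \<in> A \<and> (\<forall>y\<in>A. closed_segment x0 y \<subseteq> A)"

definition bdist :: "'a::real_normed_vector set \<Rightarrow> 'a \<Rightarrow> real" where
  "bdist \<Omega> x = infdist x (frontier \<Omega>)"

definition variation_sums :: "(real \<Rightarrow> 'a::real_normed_vector) \<Rightarrow> real \<Rightarrow> real \<Rightarrow> real set" where
  "variation_sums \<gamma> a b =
     {(\<Sum>i<n. norm (\<gamma> (p (Suc i)) - \<gamma> (p i))) | (n::nat) (p::nat \<Rightarrow> real).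
        mono_on {..n} p \<and> p 0 = a \<and> p n = b}"

definition rectifiable_path :: "(real \<Rightarrow> 'a::real_normed_vector) \<Rightarrow> bool" where
  "rectifiable_path \<gamma> \<longleftrightarrow> path \<gamma> \<and> bdd_above (variation_sums \<gamma> 0 1)"

text \<open>Norm arc length of \<open>\<gamma>\<close> on \<open>[0,t]\<close>. Clamping \<open>t\<close> to \<open>[0,1]\<close> makes it a nondecreasing
  continuous function on the whole line when \<open>\<gamma>\<close> is a rectifiable path, as
  \<open>interval_measure\<close> requires.\<close>

definition arclength :: "(real \<Rightarrow> 'a::real_normed_vector) \<Rightarrow> real \<Rightarrow> real" where
  "arclength \<gamma> t = Sup (variation_sums \<gamma> 0 (max 0 (min 1 t)))"

text \<open>The integral with respect to norm arc length is the Lebesgue-Stieltjes integral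
  with respect to the arc length function.\<close>

definition qh_length :: "'a::real_normed_vector set \<Rightarrow> (real \<Rightarrow> 'a) \<Rightarrow> real" where
  "qh_length \<Omega> \<gamma> = (LINT t:{0..1}|interval_measure (arclength \<gamma>). 1 / bdist \<Omega> (\<gamma> t))"

text \<open>The infimum is taken over a set that is bounded below by 0, and nonempty whenever
  \<open>\<Omega>\<close> is open and connected and contains both points.\<close>

definition qh_dist :: "'a::real_normed_vector set \<Rightarrow> 'a \<Rightarrow> 'a \<Rightarrow> real" where
  "qh_dist \<Omega> x y =
     Inf {qh_length \<Omega> \<gamma> | \<gamma>. rectifiable_path \<gamma> \<and> path_image \<gamma> \<subseteq> \<Omega> \<and>
                              pathstart \<gamma> = x \<and> pathfinish \<gamma> = y}"

definition dr_dist :: "'a::real_normed_vector set \<Rightarrow> 'a \<Rightarrow> 'a \<Rightarrow> real" where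
  "dr_dist \<Omega> x y = ln (1 + norm (x - y) / min (bdist \<Omega> x) (bdist \<Omega> y))"

definition qh_cball :: "'a::real_normed_vector set \<Rightarrow> 'a \<Rightarrow> real \<Rightarrow> 'a set" where
  "qh_cball \<Omega> x r = {y \<in> \<Omega>. qh_dist \<Omega> x y \<le> r}"

definition dr_cball :: "'a::real_normed_vector set \<Rightarrow> 'a \<Rightarrow> real \<Rightarrow> 'a set" where
  "dr_cball \<Omega> x r = {y \<in> \<Omega>. dr_dist \<Omega> x y \<le> r}"

end

theory Submission
  imports Defs
begin

text \<open>
  The contraction \<open>z \<mapsto> x0 + c (z - x0)\<close> with \<open>0 < c \<le> 1\<close> maps a domain that is starlike with
  respect to \<open>x0\<close> into itself and shrinks the distance to the boundary at most by the factor \<open>c\<close>,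
  because it maps the ball of radius \<open>d(y)\<close> about \<open>y\<close> onto a ball of radius \<open>c d(y)\<close> inside the
  domain. Lengths shrink exactly by the factor \<open>c\<close>, so neither the distance-ratio distance from
  \<open>x0\<close> nor the quasihyperbolic length of a path increases under the contraction.
\<close>

section \<open>Distance to the boundary\<close>

lemma starlike_wrtD:
  assumes "starlike_wrt x0 A" "y \<in> A" "0 \<le> c" "c \<le> 1"
  shows "x0 + c *\<^sub>R (y - x0) \<in> A"
proof -
  have "x0 + c *\<^sub>R (y - x0) = (1 - c) *\<^sub>R x0 + c *\<^sub>R y"
    by (simp add: algebra_simps)
  then have "x0 + c *\<^sub>R (y - x0) \<in> closed_segment x0 y"
    using assms(3,4) unfolding closed_segment_def by blast
  then show ?thesis
    using assms(1,2) unfolding starlike_wrt_def by blast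
qed

text \<open>The value \<open>c = 0\<close> is kept apart because later estimates invert the
  contraction; there the image is \<open>x0\<close>, supplied by the first premise.\<close>

lemma starlike_wrtI:
  assumes "x0 \<in> A" "\<And>y c. y \<in> A \<Longrightarrow> 0 < c \<Longrightarrow> c \<le> 1 \<Longrightarrow> x0 + c *\<^sub>R (y - x0) \<in> A"
  shows "starlike_wrt x0 A"
  unfolding starlike_wrt_def
proof (intro conjI ballI subsetI)
  fix y z assume y: "y \<in> A" and "z \<in> closed_segment x0 y"
  then obtain c where c: "0 \<le> c" "c \<le> 1" and z: "z = (1 - c) *\<^sub>R x0 + c *\<^sub>R y"
    unfolding closed_segment_def by blast
  have z': "z = x0 + c *\<^sub>R (y - x0)"
    by (simp add: z algebra_simps)
  show "z \<in> A"
    using assms(1) assms(2)[OF y, of c] c z' by (cases "c = 0") auto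
qed (rule assms(1))

lemma bdist_pos:
  assumes "open \<Omega>" "\<Omega> \<noteq> UNIV" "x \<in> \<Omega>"
  shows "0 < bdist \<Omega> x"
  unfolding bdist_def
proof (rule infdist_pos_not_in_closed)
  show "frontier \<Omega> \<noteq> {}"
    using assms by (intro frontier_not_empty) auto
  show "x \<notin> frontier \<Omega>"
    using assms by (simp add: frontier_def interior_open)
qed simp

text \<open>A ball is connected, so if it met both \<open>\<Omega>\<close> and its complement it
  would meet the frontier, yet no frontier point is closer than \<open>bdist \<Omega> x\<close>. For
  radius 0 the ball is empty.\<close>

lemma ball_bdist_subset:
  assumes "x \<in> \<Omega>"
  shows "ball x (bdist \<Omega> x) \<subseteq> \<Omega>"
proof (rule ccontr)
  assume no: "\<not> ?thesis"
  then have "0 < bdist \<Omega> x"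
    by (metis ball_empty empty_subsetI linorder_not_less)
  then have "x \<in> ball x (bdist \<Omega> x) \<inter> \<Omega>"
    using assms by simp
  then have "ball x (bdist \<Omega> x) \<inter> \<Omega> \<noteq> {}"
    by blast
  with no have "ball x (bdist \<Omega> x) \<inter> frontier \<Omega> \<noteq> {}"
    by (intro connected_Int_frontier) auto
  then obtain w where "w \<in> frontier \<Omega>" "dist x w < bdist \<Omega> x"
    by auto
  then show False
    unfolding bdist_def using infdist_le[of w "frontier \<Omega>" x] by simp
qed

text \<open>A frontier point \<open>w\<close> closer to the image than
  \<open>c * bdist \<Omega> y\<close> would have its preimage \<open>v\<close> in the ball about
  \<open>y\<close>, hence in \<open>\<Omega>\<close>. Contracting \<open>v\<close> again puts
  \<open>w\<close> into the open set \<open>\<Omega>\<close>, which is disjoint from its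
  frontier.\<close>

lemma bdist_contraction_ge:
  assumes "open \<Omega>" "\<Omega> \<noteq> UNIV" "starlike_wrt x0 \<Omega>" "y \<in> \<Omega>" "0 < c" "c \<le> 1"
  shows "c * bdist \<Omega> y \<le> bdist \<Omega> (x0 + c *\<^sub>R (y - x0))" (is "_ \<le> bdist \<Omega> ?z")
proof -
  have ne: "frontier \<Omega> \<noteq> {}"
    using assms(2,4) by (intro frontier_not_empty) auto
  have "c * bdist \<Omega> y \<le> dist ?z w" if w: "w \<in> frontier \<Omega>" for w
  proof (rule ccontr)
    assume lt: "\<not> ?thesis"
    define v where "v = x0 + (w - x0) /\<^sub>R c"
    have "y - v = (?z - w) /\<^sub>R c"
      using assms(5) by (simp add: v_def algebra_simps)
    then have "dist y v = dist ?z w / c"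
      using assms(5) by (simp add: dist_norm divide_inverse mult.commute)
    also have "\<dots> < bdist \<Omega> y"
      using lt assms(5) by (simp add: field_simps)
    finally have "v \<in> \<Omega>"
      using ball_bdist_subset[OF assms(4)] by auto
    then have "x0 + c *\<^sub>R (v - x0) \<in> \<Omega>"
      using starlike_wrtD assms(3,5,6) by (metis less_imp_le)
    moreover have "x0 + c *\<^sub>R (v - x0) = w"
      using assms(5) by (simp add: v_def)
    ultimately show False
      using w assms(1) by (simp add: frontier_def interior_open)
  qed
  then show ?thesis
    unfolding bdist_def infdist_notempty[OF ne] using ne by (intro cINF_greatest)
qed

lemma dr_dist_contraction_le:
  assumes "open \<Omega>" "\<Omega> \<noteq> UNIV" "starlike_wrt x0 \<Omega>" "y \<in> \<Omega>" "0 < c" "c \<le> 1"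
  shows "dr_dist \<Omega> x0 (x0 + c *\<^sub>R (y - x0)) \<le> dr_dist \<Omega> x0 y"
proof -
  let ?z = "x0 + c *\<^sub>R (y - x0)"
  have x0: "x0 \<in> \<Omega>"
    using assms(3) by (simp add: starlike_wrt_def)
  note pos = bdist_pos[OF assms(1,2)]
  have m: "0 < min (bdist \<Omega> x0) (bdist \<Omega> y)"
    using pos[OF x0] pos[OF assms(4)] by simp
  \<comment> \<open>The minimum shrinks at most by the factor \<open>c\<close>: the term at
    \<open>x0\<close> is unchanged and \<open>c \<le> 1\<close>, the term at \<open>y\<close> obeys
    \<open>bdist_contraction_ge\<close>. The numerator shrinks by exactly \<open>c\<close>, so the
    factor cancels.\<close>
  have "c * min (bdist \<Omega> x0) (bdist \<Omega> y) \<le> bdist \<Omega> x0"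
    using mult_mono[of c 1 "min (bdist \<Omega> x0) (bdist \<Omega> y)" "bdist \<Omega> x0"] assms m by simp
  moreover have "c * min (bdist \<Omega> x0) (bdist \<Omega> y) \<le> c * bdist \<Omega> y"
    using assms(5) by (intro mult_left_mono) auto
  ultimately have le: "c * min (bdist \<Omega> x0) (bdist \<Omega> y) \<le> min (bdist \<Omega> x0) (bdist \<Omega> ?z)"
    using bdist_contraction_ge[OF assms] by simp
  have z: "0 < min (bdist \<Omega> x0) (bdist \<Omega> ?z)"
    using le m assms(5) by (meson less_le_trans mult_pos_pos)
  have "norm (x0 - ?z) = c * norm (x0 - y)"
    using assms(5) by (simp add: norm_minus_commute)
  then have "norm (x0 - ?z) / min (bdist \<Omega> x0) (bdist \<Omega> ?z)
      \<le> (c * norm (x0 - y)) / (c * min (bdist \<Omega> x0) (bdist \<Omega> y))"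
    using le m z assms(5) by (simp only:, intro divide_left_mono) (auto intro!: mult_pos_pos)
  also have "\<dots> = norm (x0 - y) / min (bdist \<Omega> x0) (bdist \<Omega> y)"
    using assms(5) by simp
  finally have "norm (x0 - ?z) / min (bdist \<Omega> x0) (bdist \<Omega> ?z)
      \<le> norm (x0 - y) / min (bdist \<Omega> x0) (bdist \<Omega> y)" .
  moreover have "0 \<le> norm (x0 - ?z) / min (bdist \<Omega> x0) (bdist \<Omega> ?z)"
    using z by (intro divide_nonneg_pos) auto
  ultimately show ?thesis
    unfolding dr_dist_def by simp
qed

section \<open>Arc length\<close>

definition polygon_length :: "(real \<Rightarrow> 'a::real_normed_vector) \<Rightarrow> nat \<Rightarrow> (nat \<Rightarrow> real) \<Rightarrow> real" where
  "polygon_length \<gamma> n p = (\<Sum>i<n. norm (\<gamma> (p (Suc i)) - \<gamma> (p i)))"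

lemma variation_sums_eq:
  "variation_sums \<gamma> a b = {polygon_length \<gamma> n p | n p. mono_on {..n} p \<and> p 0 = a \<and> p n = b}"
  unfolding variation_sums_def polygon_length_def ..

lemma polygon_length_in_variation_sums:
  assumes "mono_on {..n} p" "p 0 = a" "p n = b"
  shows "polygon_length \<gamma> n p \<in> variation_sums \<gamma> a b"
  using assms unfolding variation_sums_eq by blast

lemma segment_in_variation_sums:
  assumes "a \<le> b"
  shows "norm (\<gamma> b - \<gamma> a) \<in> variation_sums \<gamma> a b"
proof -
  have "polygon_length \<gamma> 1 (\<lambda>i. if i = 0 then a else b) \<in> variation_sums \<gamma> a b"
    using assms by (intro polygon_length_in_variation_sums) (auto simp: mono_on_def)
  then show ?thesis
    by (simp add: polygon_length_def)
qed

lemma variation_sums_add: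
  assumes "u \<in> variation_sums \<gamma> a b" "v \<in> variation_sums \<gamma> b c"
  shows "u + v \<in> variation_sums \<gamma> a c"
proof -
  obtain n p where p: "u = polygon_length \<gamma> n p" "mono_on {..n} p" "p 0 = a" "p n = b"
    using assms(1) unfolding variation_sums_eq by blast
  obtain m q where q: "v = polygon_length \<gamma> m q" "mono_on {..m} q" "q 0 = b" "q m = c"
    using assms(2) unfolding variation_sums_eq by blast
  \<comment> \<open>Both branches would give \<open>b\<close> at index \<open>n\<close>, since
    \<open>p n = q 0\<close>; hence the shift identity below also holds for
    \<open>i = 0\<close>.\<close>
  define r where "r i = (if i \<le> n then p i else q (i - n))" for i
  have shift: "r (i + n) = q i" for i
    using p(4) q(3) by (simp add: r_def)
  have "mono_on {..n + m} r"
  proof (rule mono_onI)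
    fix i j assume ij: "i \<in> {..n + m}" "j \<in> {..n + m}" "i \<le> j"
    consider "j \<le> n" | "i \<le> n" "n < j" | "n < i"
      by linarith
    then show "r i \<le> r j"
    proof cases
      case 1
      then show ?thesis
        using ij mono_onD[OF p(2), of i j] by (simp add: r_def)
    next
      case 2
      then have "p i \<le> p n" "q 0 \<le> q (j - n)"
        using ij mono_onD[OF p(2), of i n] mono_onD[OF q(2), of 0 "j - n"] by auto
      then show ?thesis
        using 2 p(4) q(3) by (simp add: r_def)
    next
      case 3
      then show ?thesis
        using ij mono_onD[OF q(2), of "i - n" "j - n"] by (simp add: r_def)
    qed
  qed
  moreover have "r 0 = a" "r (n + m) = c"
    using p q shift[of m] by (simp_all add: r_def add.commute)
  moreover have "polygon_length \<gamma> (n + m) r = u + v"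
  proof -
    let ?f = "\<lambda>i. norm (\<gamma> (r (Suc i)) - \<gamma> (r i))"
    have "polygon_length \<gamma> (n + m) r = sum ?f {0..<n} + sum ?f {n..<n + m}"
      unfolding polygon_length_def lessThan_atLeast0 by (rule sum.atLeastLessThan_concat[symmetric]) auto
    also have "sum ?f {0..<n} = u"
      unfolding p(1) polygon_length_def lessThan_atLeast0 by (intro sum.cong) (auto simp: r_def)
    also have "sum ?f {n..<n + m} = (\<Sum>i\<in>{0..<m}. ?f (i + n))"
      using sum.shift_bounds_nat_ivl[of ?f 0 n m] by (simp add: add.commute)
    also have "\<dots> = v"
      unfolding q(1) polygon_length_def lessThan_atLeast0
      using shift shift[of "Suc i" for i] by (intro sum.cong) auto
    finally show ?thesis .
  qed
  ultimately show ?thesis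
    using polygon_length_in_variation_sums by metis
qed

text \<open>An edge whose parameters lie on one side of \<open>s\<close> survives in one of the
  truncated polygons and collapses to a point in the other. For an edge straddling \<open>s\<close>
  the claim is the triangle inequality through \<open>\<gamma> s\<close>.\<close>

lemma polygon_length_split:
  "polygon_length \<gamma> n p
    \<le> polygon_length \<gamma> n (\<lambda>i. min (p i) s) + polygon_length \<gamma> n (\<lambda>i. max (p i) s)"
  unfolding polygon_length_def sum.distrib[symmetric]
proof (rule sum_mono)
  fix i
  have "norm (\<gamma> (p (Suc i)) - \<gamma> (p i)) \<le> norm (\<gamma> (p (Suc i)) - \<gamma> s) + norm (\<gamma> s - \<gamma> (p i))"
    using norm_triangle_ineq[of "\<gamma> (p (Suc i)) - \<gamma> s" "\<gamma> s - \<gamma> (p i)"] by simp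
  then show "norm (\<gamma> (p (Suc i)) - \<gamma> (p i))
      \<le> norm (\<gamma> (min (p (Suc i)) s) - \<gamma> (min (p i) s)) +
        norm (\<gamma> (max (p (Suc i)) s) - \<gamma> (max (p i) s))"
    by (auto simp: min_def max_def norm_minus_commute)
qed

text \<open>Appending the endpoint 1 to a partition of \<open>[0,t]\<close> adds a nonnegative edge
  and gives a partition of \<open>[0,1]\<close>.\<close>

lemma bdd_above_variation_sums:
  assumes "bdd_above (variation_sums \<gamma> 0 1)" "0 \<le> t" "t \<le> 1"
  shows "bdd_above (variation_sums \<gamma> 0 t)"
proof -
  obtain B where B: "\<And>v. v \<in> variation_sums \<gamma> 0 1 \<Longrightarrow> v \<le> B"
    using assms(1) unfolding bdd_above_def by blast
  have "v \<le> B" if "v \<in> variation_sums \<gamma> 0 t" for v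
    using B[OF variation_sums_add[OF that segment_in_variation_sums[OF assms(3)]]]
      norm_ge_zero[of "\<gamma> 1 - \<gamma> t"] by linarith
  then show ?thesis
    by (rule bdd_aboveI)
qed

section \<open>The arc length function: superadditivity, monotonicity, continuity\<close>

lemma arclength_clamp: "arclength \<gamma> (max 0 (min 1 t)) = arclength \<gamma> t"
  unfolding arclength_def by (simp add: min_def max_def)

lemma variation_sum_le_arclength:
  assumes "rectifiable_path \<gamma>" "0 \<le> t" "t \<le> 1" "v \<in> variation_sums \<gamma> 0 t"
  shows "v \<le> arclength \<gamma> t"
  using assms bdd_above_variation_sums[of \<gamma> t]
  unfolding arclength_def rectifiable_path_def by (auto intro!: cSup_upper)

text \<open>Concatenate a partition of \<open>[0,s]\<close> with the one behind \<open>v\<close>,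
  then take the supremum over the former. This half of additivity suffices for both monotonicity and
  continuity.\<close>

lemma arclength_add_le:
  assumes "rectifiable_path \<gamma>" "0 \<le> s" "s \<le> t" "t \<le> 1" "v \<in> variation_sums \<gamma> s t"
  shows "arclength \<gamma> s + v \<le> arclength \<gamma> t"
proof -
  have "arclength \<gamma> s \<le> arclength \<gamma> t - v"
    unfolding arclength_def[of _ s]
  proof (rule cSup_least)
    show "variation_sums \<gamma> 0 (max 0 (min 1 s)) \<noteq> {}"
      using segment_in_variation_sums[of 0 "max 0 (min 1 s)" \<gamma>] by force
    fix u assume "u \<in> variation_sums \<gamma> 0 (max 0 (min 1 s))"
    then have "u + v \<in> variation_sums \<gamma> 0 t"
      using assms variation_sums_add[of u \<gamma> 0 s v t] by simp
    then show "u \<le> arclength \<gamma> t - v"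
      using variation_sum_le_arclength[of \<gamma> t "u + v"] assms by simp
  qed
  then show ?thesis
    by simp
qed

lemma mono_arclength:
  assumes "rectifiable_path \<gamma>"
  shows "mono (arclength \<gamma>)"
proof (rule monoI)
  fix s t :: real assume "s \<le> t"
  then have "max 0 (min 1 s) \<le> max 0 (min 1 t)"
    by linarith
  then have "arclength \<gamma> s + norm (\<gamma> (max 0 (min 1 t)) - \<gamma> (max 0 (min 1 s))) \<le> arclength \<gamma> t"
    using arclength_add_le[OF assms _ _ _ segment_in_variation_sums,
        of "max 0 (min 1 s)" "max 0 (min 1 t)"] by (simp add: arclength_clamp)
  then show "arclength \<gamma> s \<le> arclength \<gamma> t"
    by (rule order_trans[rotated]) simp
qed

text \<open>If the partition \<open>p\<close> of \<open>[0,1]\<close> almost realises the total length \<open>L\<close>, then the length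
  of \<open>\<gamma>\<close> on \<open>[0,t]\<close> is uniformly close to \<open>L\<close> minus the length of the polygon inscribed at the
  points \<open>max (p i) t\<close>, which depends continuously on \<open>t\<close>.\<close>

lemma continuous_arclength:
  assumes "rectifiable_path \<gamma>"
  shows "continuous_on UNIV (arclength \<gamma>)"
proof (rule uniform_limit_theorem[where F = "at_right 0"])
  define L where "L = arclength \<gamma> 1"
  define cl where "cl t = max 0 (min 1 t)" for t :: real
  have approx: "\<exists>g. continuous_on UNIV g \<and> (\<forall>t. \<bar>arclength \<gamma> t - g t\<bar> < e)" if "0 < e" for e
  proof -
    have "\<exists>v\<in>variation_sums \<gamma> 0 1. L - e < v"
    proof -
      have "L - e < Sup (variation_sums \<gamma> 0 1)"
        using that by (simp add: L_def arclength_def)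
      moreover have "variation_sums \<gamma> 0 1 \<noteq> {}"
        using segment_in_variation_sums[of 0 1 \<gamma>] by force
      ultimately show ?thesis
        using assms unfolding rectifiable_path_def by (simp add: less_cSup_iff)
    qed
    then obtain n p where p: "mono_on {..n} p" "p 0 = 0" "p n = 1" "L - e < polygon_length \<gamma> n p"
      unfolding variation_sums_eq by blast
    have p01: "0 \<le> p i \<and> p i \<le> 1" if "i \<le> n" for i
      using mono_onD[OF p(1), of 0 i] mono_onD[OF p(1), of i n] that p(2,3) by auto
    define g where "g t = L - polygon_length \<gamma> n (\<lambda>i. max (p i) (cl t))" for t
    have "continuous_on {0..1} \<gamma>"
      using assms by (simp add: rectifiable_path_def path_def)
    then have "continuous_on UNIV (\<lambda>t. \<gamma> (max (p i) (cl t)))" if "i \<le> n" for i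
    proof (rule continuous_on_compose2)
      show "continuous_on UNIV (\<lambda>t. max (p i) (cl t))"
        unfolding cl_def by (intro continuous_intros)
      show "(\<lambda>t. max (p i) (cl t)) ` UNIV \<subseteq> {0..1}"
        using p01[OF that] by (auto simp: cl_def)
    qed
    then have "continuous_on UNIV g"
      unfolding g_def polygon_length_def by (intro continuous_intros) auto
    moreover have "\<bar>arclength \<gamma> t - g t\<bar> < e" for t
    proof -
      have c: "0 \<le> cl t" "cl t \<le> 1"
        by (auto simp: cl_def)
      have F: "arclength \<gamma> (cl t) = arclength \<gamma> t"
        unfolding cl_def by (rule arclength_clamp)
      have "mono_on {..n} (\<lambda>i. max (p i) (cl t))" "mono_on {..n} (\<lambda>i. min (p i) (cl t))"
        using p(1) by (auto intro!: mono_onI max.mono min.mono dest: mono_onD)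
      then have "polygon_length \<gamma> n (\<lambda>i. max (p i) (cl t)) \<in> variation_sums \<gamma> (cl t) 1"
        "polygon_length \<gamma> n (\<lambda>i. min (p i) (cl t)) \<in> variation_sums \<gamma> 0 (cl t)"
        using p(2,3) c by (auto intro!: polygon_length_in_variation_sums)
      \<comment> \<open>Write \<open>m\<close> and \<open>M\<close> for the polygons truncated by
        \<open>min\<close> and \<open>max\<close>. Then
        \<open>m \<le> arclength \<gamma> t \<le> L - M = g t\<close>, while
        \<open>L - e < m + M\<close> forces \<open>m > g t - e\<close>.\<close>
      then have "arclength \<gamma> t + polygon_length \<gamma> n (\<lambda>i. max (p i) (cl t)) \<le> L"
        "polygon_length \<gamma> n (\<lambda>i. min (p i) (cl t)) \<le> arclength \<gamma> t"
        using arclength_add_le[OF assms c(1) c(2)] variation_sum_le_arclength[OF assms c]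
        by (auto simp: L_def F)
      then show ?thesis
        using p(4) polygon_length_split[of \<gamma> n p "cl t"] unfolding g_def by linarith
    qed
    ultimately show ?thesis
      by blast
  qed
  \<comment> \<open>Choice turns the approximants into a family indexed by the error, which
    converges uniformly as \<open>e\<close> tends to 0 from the right.\<close>
  define G where "G e = (SOME g. continuous_on UNIV g \<and> (\<forall>t. \<bar>arclength \<gamma> t - g t\<bar> < e))" for e
  have G: "continuous_on UNIV (G e)" "\<bar>arclength \<gamma> t - G e t\<bar> < e" if "0 < e" for e t
    using someI_ex[OF approx[OF that]] unfolding G_def by auto
  show "\<forall>\<^sub>F e in at_right 0. continuous_on UNIV (G e)"
    using G(1) by (auto simp: eventually_at_filter)
  show "uniform_limit UNIV G (arclength \<gamma>) (at_right 0)"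
  proof (rule uniform_limitI)
    fix e :: real assume "0 < e"
    then have "\<forall>\<^sub>F d in at_right 0. d \<in> {0<..<e}"
      by (rule eventually_at_right_real)
    then show "\<forall>\<^sub>F d in at_right 0. \<forall>t\<in>UNIV. dist (G d t) (arclength \<gamma> t) < e"
    proof eventually_elim
      case (elim d)
      show ?case
      proof
        fix t
        show "dist (G d t) (arclength \<gamma> t) < e"
          using G(2)[of d t] elim by (auto simp: dist_real_def)
      qed
    qed
  qed
qed simp

section \<open>Scaling of lengths under the contraction, and rectifiable segments\<close>

lemma variation_sums_contraction:
  fixes x0 :: "'a::real_normed_vector"
  assumes "0 \<le> c"
  shows "variation_sums (\<lambda>t. x0 + c *\<^sub>R (\<gamma> t - x0)) a b = (*) c ` variation_sums \<gamma> a b"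
proof -
  have "polygon_length (\<lambda>t. x0 + c *\<^sub>R (\<gamma> t - x0)) n p = c * polygon_length \<gamma> n p" for n p
    using assms unfolding polygon_length_def sum_distrib_left
    by (intro sum.cong refl) (simp flip: scaleR_diff_right)
  then show ?thesis
    unfolding variation_sums_eq by (auto simp: image_def)
qed

lemma rectifiable_path_contraction:
  fixes x0 :: "'a::real_normed_vector"
  assumes "rectifiable_path \<gamma>" "0 \<le> c"
  shows "rectifiable_path (\<lambda>t. x0 + c *\<^sub>R (\<gamma> t - x0))"
proof -
  have "bdd_above ((*) c ` variation_sums \<gamma> 0 1)"
    using assms unfolding rectifiable_path_def
    by (intro bdd_above_image_mono) (auto simp: mono_def mult_left_mono)
  then show ?thesis
    using assms unfolding rectifiable_path_def variation_sums_contraction[OF assms(2)] path_def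
    by (intro conjI continuous_intros) auto
qed

text \<open>Multiplication by \<open>c\<close> is monotone and continuous, so it commutes with the
  supremum. The case \<open>c = 0\<close> is used later to find the arc length of a constant
  path.\<close>

lemma arclength_contraction:
  fixes x0 :: "'a::real_normed_vector"
  assumes "rectifiable_path \<gamma>" "0 \<le> c"
  shows "arclength (\<lambda>t. x0 + c *\<^sub>R (\<gamma> t - x0)) t = c * arclength \<gamma> t"
proof -
  let ?V = "variation_sums \<gamma> 0 (max 0 (min 1 t))"
  have "mono ((*) c)"
    using assms(2) by (auto simp: mono_def mult_left_mono)
  moreover have "?V \<noteq> {}"
    using segment_in_variation_sums[of 0 "max 0 (min 1 t)" \<gamma>] by force
  moreover have "bdd_above ?V"
    using assms(1) bdd_above_variation_sums[of \<gamma> "max 0 (min 1 t)"]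
    by (simp add: rectifiable_path_def)
  ultimately have "c * Sup ?V = Sup ((*) c ` ?V)"
    using continuous_at_Sup_mono[of "(*) c" ?V] by (simp add: continuous_mult_left)
  then show ?thesis
    unfolding arclength_def variation_sums_contraction[OF assms(2)] by simp
qed

text \<open>Along a monotone partition the edge lengths telescope, so every inscribed polygon has
  length exactly \<open>norm (y - x)\<close>.\<close>

lemma rectifiable_linepath: "rectifiable_path (linepath x y)"
proof -
  have "v \<le> norm (y - x)" if v: "v \<in> variation_sums (linepath x y) 0 1" for v
  proof -
    obtain n p where p: "v = polygon_length (linepath x y) n p" "mono_on {..n} p" "p 0 = 0" "p n = 1"
      using v unfolding variation_sums_eq by blast
    have "norm (linepath x y (p (Suc i)) - linepath x y (p i)) = (p (Suc i) - p i) * norm (y - x)"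
      if "i < n" for i
    proof -
      have "linepath x y (p (Suc i)) - linepath x y (p i) = (p (Suc i) - p i) *\<^sub>R (y - x)"
        by (simp add: linepath_def algebra_simps)
      moreover have "p i \<le> p (Suc i)"
        using mono_onD[OF p(2), of i "Suc i"] that by simp
      ultimately show ?thesis
        by simp
    qed
    then have "v = (\<Sum>i<n. p (Suc i) - p i) * norm (y - x)"
      unfolding p(1) polygon_length_def sum_distrib_right by (intro sum.cong) auto
    then show ?thesis
      using p(3,4) by (simp add: sum_lessThan_telescope)
  qed
  then show ?thesis
    unfolding rectifiable_path_def by (meson bdd_aboveI path_linepath)
qed

section \<open>Quasihyperbolic length\<close>

text \<open>Both measures agree on half-open intervals, which generate the Borel sets, are stable
  under intersection, and exhaust the line by sets of finite measure; uniqueness of measures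
  applies.\<close>

lemma interval_measure_cmult:
  fixes F :: "real \<Rightarrow> real"
  assumes "mono F" "\<And>a. continuous (at_right a) F" "0 \<le> c"
  shows "interval_measure (\<lambda>t. c * F t) = density (interval_measure F) (\<lambda>_. ennreal c)"
proof (rule measure_eqI_generator_eq[where \<Omega> = UNIV])
  let ?E = "range (\<lambda>(a, b). {a<..b::real})"
  have cF: "c * F x \<le> c * F y" if "x \<le> y" for x y
    using assms(1,3) that by (simp add: monoD mult_left_mono)
  have cont: "continuous (at_right a) (\<lambda>t. c * F t)" for a
    by (intro continuous_intros assms(2))
  note Ioc = emeasure_interval_measure_Ioc_eq[of "\<lambda>t. c * F t", OF cF cont]
    emeasure_interval_measure_Ioc_eq[of F, OF monoD[OF assms(1)] assms(2)]
  show "emeasure (interval_measure (\<lambda>t. c * F t)) X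
      = emeasure (density (interval_measure F) (\<lambda>_. ennreal c)) X" if X: "X \<in> ?E" for X
  proof -
    obtain a b where "X = {a<..b}"
      using X by auto
    then show ?thesis
      using assms(3) monoD[OF assms(1), of a b]
      by (simp add: Ioc emeasure_density_const right_diff_distrib flip: ennreal_mult)
  qed
  show "(\<Union>i. {- real (i::nat)<..real i}) = UNIV"
  proof (intro equalityI subsetI)
    fix x :: real
    obtain n where "\<bar>x\<bar> < real n"
      using reals_Archimedean2 by blast
    then show "x \<in> (\<Union>i. {- real i<..real i})"
      by (intro UN_I[of n]) auto
  qed simp
  show "emeasure (interval_measure (\<lambda>t. c * F t)) {- real (i::nat)<..real i} \<noteq> \<infinity>" for i
    by (simp add: Ioc)
qed (auto simp: Int_stable_def borel_sigma_sets_Ioc)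

text \<open>The integrand is continuous on a compact interval, hence bounded, and the measure of
  that interval is finite. Separate paths \<open>\<gamma>\<close> and \<open>\<delta>\<close> appear
  because the integrand of the contracted path is later integrated against the arc length of the
  original one.\<close>

lemma qh_integrable:
  assumes "open \<Omega>" "\<Omega> \<noteq> UNIV" "rectifiable_path \<gamma>" "rectifiable_path \<delta>" "path_image \<delta> \<subseteq> \<Omega>"
  shows "set_integrable (interval_measure (arclength \<gamma>)) {0..1} (\<lambda>t. 1 / bdist \<Omega> (\<delta> t))"
proof -
  let ?M = "interval_measure (arclength \<gamma>)" and ?f = "\<lambda>t. 1 / bdist \<Omega> (\<delta> t)"
  have pos: "0 < bdist \<Omega> (\<delta> t)" if "t \<in> {0..1}" for t
    using assms(5) that by (intro bdist_pos[OF assms(1,2)]) (auto simp: path_image_def)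
  have cont: "continuous_on {0..1} ?f"
    using assms(4) pos unfolding rectifiable_path_def path_def bdist_def
    by (intro continuous_intros) (auto simp: less_le)
  have "compact (?f ` {0..1})"
    using cont by (intro compact_continuous_image) auto
  then obtain B where B: "\<And>t. t \<in> {0..1} \<Longrightarrow> norm (?f t) \<le> B"
    by (metis compact_imp_bounded bounded_iff imageI)
  show ?thesis
    unfolding set_integrable_def
  proof (rule Bochner_Integration.integrable_bound)
    \<comment> \<open>Continuity of the arc length excludes an atom at 0, so the closed interval
      gets the same value as the half-open one.\<close>
    have "emeasure ?M {0..1} = ennreal (arclength \<gamma> 1 - arclength \<gamma> 0)"
      using mono_arclength[OF assms(3)] continuous_arclength[OF assms(3)]
      by (intro emeasure_interval_measure_Icc) (auto simp: mono_def)
    then show "integrable ?M (\<lambda>t. indicator {0..1} t * B)"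
      by (intro integrable_mult_left) (simp add: integrable_indicator_iff)
    show "(\<lambda>t. indicator {0..1} t *\<^sub>R ?f t) \<in> borel_measurable ?M"
      using borel_measurable_continuous_on_indicator[OF _ cont] by simp
    show "AE t in ?M. norm (indicator {0..1} t *\<^sub>R ?f t) \<le> norm (indicator {0..1} t * B)"
      using B by (intro AE_I2) (force split: split_indicator)
  qed
qed

lemma qh_length_nonneg: "0 \<le> qh_length \<Omega> \<gamma>"
  unfolding qh_length_def set_lebesgue_integral_def
  by (intro Bochner_Integration.integral_nonneg) (auto simp: bdist_def infdist_nonneg)

text \<open>The arc length measure of the contracted path is \<open>c\<close> times the original
  one. Moving \<open>c\<close> into the integrand reduces the claim to the pointwise bound given by
  \<open>bdist_contraction_ge\<close>.\<close>

lemma qh_length_contraction_le: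
  fixes x0 :: "'a::real_normed_vector"
  assumes "open \<Omega>" "\<Omega> \<noteq> UNIV" "starlike_wrt x0 \<Omega>" "0 < c" "c \<le> 1"
    and "rectifiable_path \<gamma>" "path_image \<gamma> \<subseteq> \<Omega>"
  shows "qh_length \<Omega> (\<lambda>t. x0 + c *\<^sub>R (\<gamma> t - x0)) \<le> qh_length \<Omega> \<gamma>"
proof -
  let ?\<delta> = "\<lambda>t. x0 + c *\<^sub>R (\<gamma> t - x0)" and ?M = "interval_measure (arclength \<gamma>)"
  have im: "\<gamma> t \<in> \<Omega>" if "t \<in> {0..1}" for t
    using assms(7) that by (auto simp: path_image_def)
  have rect: "rectifiable_path ?\<delta>" and im': "path_image ?\<delta> \<subseteq> \<Omega>"
    using rectifiable_path_contraction[OF assms(6)] starlike_wrtD[OF assms(3) im] assms(4,5)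
    by (auto simp: path_image_def)
  note int = qh_integrable[OF assms(1,2,6)]
  have "continuous (at_right a) (arclength \<gamma>)" for a
    using continuous_arclength[OF assms(6)]
    by (simp add: continuous_on_eq_continuous_at continuous_at_imp_continuous_at_within)
  moreover have "arclength ?\<delta> = (\<lambda>t. c * arclength \<gamma> t)"
    using arclength_contraction[OF assms(6)] assms(4) by (intro ext) simp
  ultimately have "interval_measure (arclength ?\<delta>) = density ?M (\<lambda>_. ennreal c)"
    using interval_measure_cmult[OF mono_arclength[OF assms(6)], of c] assms(4) by simp
  then have "qh_length \<Omega> ?\<delta>
      = (\<integral>t. indicator {0..1} t *\<^sub>R (1 / bdist \<Omega> (?\<delta> t)) \<partial>density ?M (\<lambda>_. ennreal c))"
    by (simp add: qh_length_def set_lebesgue_integral_def)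
  also have "\<dots> = (\<integral>t. c *\<^sub>R (indicator {0..1} t *\<^sub>R (1 / bdist \<Omega> (?\<delta> t))) \<partial>?M)"
    using int[OF rect im'] assms(4) unfolding set_integrable_def
    by (intro integral_density) auto
  also have "\<dots> = (LINT t:{0..1}|?M. c * (1 / bdist \<Omega> (?\<delta> t)))"
    unfolding set_lebesgue_integral_def by (simp only: real_scaleR_def mult.left_commute)
  also have "\<dots> \<le> (LINT t:{0..1}|?M. 1 / bdist \<Omega> (\<gamma> t))"
  proof (rule set_integral_mono)
    show "set_integrable ?M {0..1} (\<lambda>t. c * (1 / bdist \<Omega> (?\<delta> t)))"
      using int[OF rect im'] by (rule set_integrable_mult_right)
    show "set_integrable ?M {0..1} (\<lambda>t. 1 / bdist \<Omega> (\<gamma> t))"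
      using int[OF assms(6,7)] .
    fix t :: real assume t: "t \<in> {0..1}"
    have "c * bdist \<Omega> (\<gamma> t) \<le> bdist \<Omega> (?\<delta> t)"
      by (rule bdist_contraction_ge[OF assms(1,2,3) im[OF t] assms(4,5)])
    moreover have "0 < bdist \<Omega> (\<gamma> t)"
      using bdist_pos[OF assms(1,2) im[OF t]] .
    moreover from calculation have "0 < bdist \<Omega> (?\<delta> t)"
      using assms(4) by (meson less_le_trans mult_pos_pos)
    ultimately show "c * (1 / bdist \<Omega> (?\<delta> t)) \<le> 1 / bdist \<Omega> (\<gamma> t)"
      by (simp add: field_simps)
  qed
  finally show ?thesis
    by (simp add: qh_length_def)
qed

section \<open>Quasihyperbolic distance from the centre\<close>

lemma qh_dist_le_qh_length:
  assumes "rectifiable_path \<gamma>" "path_image \<gamma> \<subseteq> \<Omega>" "pathstart \<gamma> = x" "pathfinish \<gamma> = y"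
  shows "qh_dist \<Omega> x y \<le> qh_length \<Omega> \<gamma>"
  unfolding qh_dist_def
proof (rule cInf_lower)
  show "bdd_below {qh_length \<Omega> \<gamma> |\<gamma>. rectifiable_path \<gamma> \<and> path_image \<gamma> \<subseteq> \<Omega> \<and>
      pathstart \<gamma> = x \<and> pathfinish \<gamma> = y}"
    using qh_length_nonneg by (intro bdd_belowI[of _ 0]) auto
qed (use assms in blast)

lemma qh_dist_contraction_le:
  fixes x0 :: "'a::real_normed_vector"
  assumes "open \<Omega>" "\<Omega> \<noteq> UNIV" "starlike_wrt x0 \<Omega>" "y \<in> \<Omega>" "0 < c" "c \<le> 1"
  shows "qh_dist \<Omega> x0 (x0 + c *\<^sub>R (y - x0)) \<le> qh_dist \<Omega> x0 y"
  unfolding qh_dist_def[of _ _ y]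
proof (rule cInf_greatest)
  \<comment> \<open>Starlikeness makes the segment admissible, so the infimum is over a nonempty
    set.\<close>
  have "path_image (linepath x0 y) \<subseteq> \<Omega>"
    using assms(3,4) by (simp add: starlike_wrt_def)
  then show "{qh_length \<Omega> \<gamma> |\<gamma>. rectifiable_path \<gamma> \<and> path_image \<gamma> \<subseteq> \<Omega> \<and>
      pathstart \<gamma> = x0 \<and> pathfinish \<gamma> = y} \<noteq> {}"
    using rectifiable_linepath[of x0 y] pathstart_linepath pathfinish_linepath by blast
  fix l assume "l \<in> {qh_length \<Omega> \<gamma> |\<gamma>. rectifiable_path \<gamma> \<and> path_image \<gamma> \<subseteq> \<Omega> \<and>
      pathstart \<gamma> = x0 \<and> pathfinish \<gamma> = y}"
  then obtain \<gamma> where \<gamma>: "l = qh_length \<Omega> \<gamma>" "rectifiable_path \<gamma>" "path_image \<gamma> \<subseteq> \<Omega>"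
    "pathstart \<gamma> = x0" "pathfinish \<gamma> = y"
    by blast
  have "path_image (\<lambda>t. x0 + c *\<^sub>R (\<gamma> t - x0)) \<subseteq> \<Omega>"
    using starlike_wrtD[OF assms(3)] \<gamma>(3) assms(5,6) by (auto simp: path_image_def)
  then have "qh_dist \<Omega> x0 (x0 + c *\<^sub>R (y - x0)) \<le> qh_length \<Omega> (\<lambda>t. x0 + c *\<^sub>R (\<gamma> t - x0))"
    using \<gamma> assms(5) by (intro qh_dist_le_qh_length rectifiable_path_contraction)
      (auto simp: pathstart_def pathfinish_def)
  also have "\<dots> \<le> l"
    unfolding \<gamma>(1) using qh_length_contraction_le[OF assms(1-3,5,6) \<gamma>(2,3)] .
  finally show "qh_dist \<Omega> x0 (x0 + c *\<^sub>R (y - x0)) \<le> l" .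
qed

text \<open>Places the centre in its own ball: the constant path has zero arc length, so it is
  integrated against the zero measure.\<close>

lemma qh_dist_self_le:
  assumes "x \<in> \<Omega>"
  shows "qh_dist \<Omega> x x \<le> 0"
proof -
  have rect: "rectifiable_path (\<lambda>_::real. x)"
    using rectifiable_linepath[of x x] by (simp add: linepath_refl)
  have arc: "arclength (\<lambda>_::real. x) = (\<lambda>_. 0)"
  proof
    fix t
    show "arclength (\<lambda>_. x) t = 0"
      using arclength_contraction[OF rect, of 0 x t] by simp
  qed
  \<comment> \<open>Scaling the zero function by 0 changes nothing, so its measure is its own
    multiple by the density 0, against which every integral vanishes.\<close>
  have "interval_measure (\<lambda>_. 0 :: real) = density (interval_measure (\<lambda>_. 0)) (\<lambda>_. 0)"
    using interval_measure_cmult[of "\<lambda>_. 0" 0] by (simp add: mono_def)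
  then have "qh_length \<Omega> (\<lambda>_. x) = integral\<^sup>L (density (interval_measure (\<lambda>_. 0)) (\<lambda>_. ennreal 0))
      (\<lambda>t. indicator {0..1} t *\<^sub>R (1 / bdist \<Omega> x))"
    unfolding qh_length_def set_lebesgue_integral_def arc by simp
  also have "\<dots> = 0"
    by (subst integral_density) auto
  finally have "qh_length \<Omega> (\<lambda>_. x) = 0" .
  then show ?thesis
    using qh_dist_le_qh_length[OF rect, of \<Omega> x x] assms
    by (auto simp: path_image_def pathstart_def pathfinish_def)
qed

theorem theorem4p3:
  fixes \<Omega> :: "'a::banach set" and x0 :: 'a
  assumes "\<exists>B::'a set. independent B \<and> card B = 2"
    and "open \<Omega>" and "connected \<Omega>" and "\<Omega> \<noteq> {}" and "\<Omega> \<noteq> UNIV"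
    and "x0 \<in> \<Omega>" and "starlike_wrt x0 \<Omega>"
  shows "\<forall>r>0. starlike_wrt x0 (dr_cball \<Omega> x0 r) \<and> starlike_wrt x0 (qh_cball \<Omega> x0 r)"
proof (intro allI impI conjI)
  fix r :: real assume r: "0 < r"
  show "starlike_wrt x0 (dr_cball \<Omega> x0 r)"
  \<comment> \<open>For both balls the centre has distance at most \<open>0 < r\<close> from itself,
    and a contraction toward it does not increase the distance.\<close>
  proof (rule starlike_wrtI)
    show "x0 \<in> dr_cball \<Omega> x0 r"
      using assms(6) r by (simp add: dr_cball_def dr_dist_def)
    fix y c assume "y \<in> dr_cball \<Omega> x0 r" "0 < c" "c \<le> (1::real)"
    then show "x0 + c *\<^sub>R (y - x0) \<in> dr_cball \<Omega> x0 r"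
      using starlike_wrtD[OF assms(7), of y c] dr_dist_contraction_le[OF assms(2,5,7), of y c]
      by (auto simp: dr_cball_def)
  qed
  show "starlike_wrt x0 (qh_cball \<Omega> x0 r)"
  proof (rule starlike_wrtI)
    show "x0 \<in> qh_cball \<Omega> x0 r"
      using assms(6) r qh_dist_self_le[OF assms(6)] by (simp add: qh_cball_def)
    fix y c assume "y \<in> qh_cball \<Omega> x0 r" "0 < c" "c \<le> (1::real)"
    then show "x0 + c *\<^sub>R (y - x0) \<in> qh_cball \<Omega> x0 r"
      using starlike_wrtD[OF assms(7), of y c] qh_dist_contraction_le[OF assms(2,5,7), of y c]
      by (auto simp: qh_cball_def)
  qed
qed

end
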